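(* Assume that for every nonempty set $A\subseteq\mathcal X\setminus\mathcal O$ there exists $x\in A$ such that $|\mathcal N_x\cap A|\le1$. Let $g\colon\mathcal O\to\mathbb R$. Then a solution $u\colon\mathcal X\to\mathbb R$ of $$\begin{cases}u(x)=H_1[u](x),&x\in\mathcal X\setminus\mathcal O,\\ u(x)=g(x),&x\in\mathcal O,\end{cases}$$ whenever it exists, is unique.
   Context: $\mathcal G=(\mathcal X,E)$ is a finite simple undirected graph, $\mathcal O\subseteq\mathcal X$ is the set of boundary vertices, and $\mathcal N_x$ is the set of neighbors of $x$. There is a fixed even integer $n\ge2$ with $|\mathcal N_x|=n$ for every $x\in\mathcal X\setminus\mathcal O$ (no degree condition on vertices of $\mathcal O$). For $u\colon\mathcal X\to\mathbb R$ and $x\in\mathcal X\setminus\mathcal O$, $$H_1[u](x)=\min_{\substack{y,z\in\mathcal N_x\\ y\ne z}}\frac{u(y)+u(z)}2.$$ *)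

theory Defs
  imports Complex_Main "Graph_Theory.Pair_Digraph"
begin

text \<open>
  Finite simple undirected graphs are the symmetric loop-free digraphs
  \<^locale>\<open>pair_graph\<close>; each undirected edge appears as its two arcs.
  Functions on vertices are total on the vertex type; the values outside
  \<^term>\<open>pverts G\<close> are irrelevant.
\<close>

definition nbrs :: "'a pair_pre_digraph \<Rightarrow> 'a \<Rightarrow> 'a set" where
  "nbrs G x = {y. (x, y) \<in> parcs G}"

text \<open>The minimum is over a nonempty set only if \<^term>\<open>x\<close> has at least two neighbours.\<close>

definition H1 :: "'a pair_pre_digraph \<Rightarrow> ('a \<Rightarrow> real) \<Rightarrow> 'a \<Rightarrow> real" where
  "H1 G u x = Min {(u y + u z) / 2 | y z. y \<in> nbrs G x \<and> z \<in> nbrs G x \<and> y \<noteq> z}"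

definition is_solution ::
  "'a pair_pre_digraph \<Rightarrow> 'a set \<Rightarrow> ('a \<Rightarrow> real) \<Rightarrow> ('a \<Rightarrow> real) \<Rightarrow> bool" where
  "is_solution G B g u \<longleftrightarrow>
     (\<forall>x \<in> pverts G - B. u x = H1 G u x) \<and> (\<forall>x \<in> B. u x = g x)"

end

theory Submission
  imports Defs
begin

text \<open>
  Suppose \<open>u - v\<close> has a positive maximum, attained on the set \<open>A\<close>, which avoids the boundary.
  If \<open>x \<in> A\<close> and \<open>y \<noteq> z\<close> are neighbours realising the minimum \<open>v x\<close>, then
  \<open>u x \<le> (u y + u z) / 2 \<le> v x + max (u - v) = u x\<close>, so \<open>y, z \<in> A\<close>. Hence every vertex of \<open>A\<close>
  has at least two neighbours in \<open>A\<close>, against the hypothesis on the graph.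
\<close>

lemma finite_nbrs: "pair_graph G \<Longrightarrow> finite (nbrs G x)"
  unfolding nbrs_def
  by (rule finite_subset[of _ "snd ` parcs G"])
    (force, simp add: pair_graph_def pair_digraph_def pair_fin_digraph.pair_finite_arcs)

lemma nbrs_subset_pverts: "pair_graph G \<Longrightarrow> nbrs G x \<subseteq> pverts G"
  by (auto simp: nbrs_def pair_graph_def pair_digraph_def pair_fin_digraph_def
      dest: pair_wf_digraph.in_arcsD2)

lemma finite_pair_averages:
  fixes w :: "'a \<Rightarrow> real"
  assumes "finite N"
  shows "finite {(w y + w z) / 2 | y z. y \<in> N \<and> z \<in> N \<and> y \<noteq> z}"
  by (rule finite_subset[of _ "(\<lambda>(y, z). (w y + w z) / 2) ` (N \<times> N)"])
    (use assms in \<open>auto intro!: image_eqI[where x = "(_, _)"]\<close>)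

lemma H1_le:
  assumes "finite (nbrs G x)" "y \<in> nbrs G x" "z \<in> nbrs G x" "y \<noteq> z"
  shows "H1 G w x \<le> (w y + w z) / 2"
  unfolding H1_def using assms by (intro Min_le finite_pair_averages) auto

text \<open>Two distinct neighbours make the set of pair averages nonempty, so its
  \<open>Min\<close> is one of its members.\<close>

lemma H1_attained:
  assumes "card (nbrs G x) \<ge> 2"
  obtains y z where "y \<in> nbrs G x" "z \<in> nbrs G x" "y \<noteq> z" "H1 G w x = (w y + w z) / 2"
proof -
  let ?S = "{(w y + w z) / 2 | y z. y \<in> nbrs G x \<and> z \<in> nbrs G x \<and> y \<noteq> z}"
  \<comment> \<open>An infinite set has \<open>card\<close> 0, so the bound forces
    finiteness.\<close>
  have fin: "finite (nbrs G x)"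
    using assms card.infinite by fastforce
  obtain a b where "a \<in> nbrs G x" "b \<in> nbrs G x" "a \<noteq> b"
    using assms card_le_Suc0_iff_eq[OF fin] by force
  then have "?S \<noteq> {}"
    by blast
  then have "H1 G w x \<in> ?S"
    unfolding H1_def by (rule Min_in[OF finite_pair_averages[OF fin]])
  then show thesis
    using that by blast
qed

lemma solution_le:
  assumes G: "pair_graph G"
    and deg: "\<forall>x \<in> pverts G - B. card (nbrs G x) \<ge> 2"
    and sparse: "\<forall>A. A \<noteq> {} \<and> A \<subseteq> pverts G - B \<longrightarrow> (\<exists>x \<in> A. card (nbrs G x \<inter> A) \<le> 1)"
    and u: "is_solution G B g u" and v: "is_solution G B g v"
    and x: "x \<in> pverts G"
  shows "u x \<le> v x"
proof (rule ccontr)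
  assume "\<not> u x \<le> v x"
  define M where "M = Max ((\<lambda>y. u y - v y) ` pverts G)"
  define A where "A = {y \<in> pverts G. u y - v y = M}"
  have fin: "finite (pverts G)"
    using G by (simp add: pair_graph_def pair_digraph_def pair_fin_digraph.pair_finite_verts)
  have le_M: "u y - v y \<le> M" if "y \<in> pverts G" for y
    unfolding M_def using fin that by auto
  have "M \<in> (\<lambda>y. u y - v y) ` pverts G"
    unfolding M_def using fin x by (intro Max_in) auto
  then have "A \<noteq> {}"
    by (auto simp: A_def)
  have "M > 0"
    using le_M[OF x] \<open>\<not> u x \<le> v x\<close> by linarith
  \<comment> \<open>On \<open>B\<close> both solutions equal \<open>g\<close>, so the difference
    there is 0, below \<open>M\<close>.\<close>
  then have "A \<subseteq> pverts G - B"
    using u v by (auto simp: A_def is_solution_def)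
  with sparse \<open>A \<noteq> {}\<close> obtain a where a: "a \<in> A" "card (nbrs G a \<inter> A) \<le> 1"
    by blast
  have a_int: "a \<in> pverts G - B"
    using a \<open>A \<subseteq> pverts G - B\<close> by blast
  \<comment> \<open>The pair is optimal for \<open>v\<close>; for \<open>u\<close> it is merely a
    competitor in the minimum, which bounds \<open>u a\<close> from above.\<close>
  obtain y z where yz: "y \<in> nbrs G a" "z \<in> nbrs G a" "y \<noteq> z" "H1 G v a = (v y + v z) / 2"
    using H1_attained deg a_int by metis
  have "u a \<le> (u y + u z) / 2"
    using H1_le[OF finite_nbrs[OF G] yz(1-3)] u a_int by (simp add: is_solution_def)
  moreover have "v a = (v y + v z) / 2"
    using v a_int yz(4) by (simp add: is_solution_def)
  moreover have "u a - v a = M"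
    using a by (simp add: A_def)
  moreover have mem: "y \<in> pverts G" "z \<in> pverts G"
    using yz nbrs_subset_pverts[OF G] by blast+
  \<comment> \<open>The differences at \<open>y\<close> and \<open>z\<close> average to at least
    \<open>M\<close>, and neither exceeds \<open>M\<close>, so both equal \<open>M\<close>.\<close>
  ultimately have "u y - v y = M" "u z - v z = M"
    using le_M[of y] le_M[of z] by (auto simp: field_simps)
  then have "y \<in> nbrs G a \<inter> A" "z \<in> nbrs G a \<inter> A"
    using yz mem by (auto simp: A_def)
  then show False
    using a(2) \<open>y \<noteq> z\<close> card_le_Suc0_iff_eq[of "nbrs G a \<inter> A"] finite_nbrs[OF G] by auto
qed

theorem corollary5p3:
  fixes G :: "'a pair_pre_digraph" and B :: "'a set" and n :: nat
    and g u v :: "'a \<Rightarrow> real"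
  assumes "pair_graph G"
    and "B \<subseteq> pverts G"
    and "even n" and "n \<ge> 2"
    and "\<forall>x \<in> pverts G - B. card (nbrs G x) = n"
    and "\<forall>A. A \<noteq> {} \<and> A \<subseteq> pverts G - B \<longrightarrow> (\<exists>x \<in> A. card (nbrs G x \<inter> A) \<le> 1)"
    and "is_solution G B g u"
    and "is_solution G B g v"
  shows "\<forall>x \<in> pverts G. u x = v x"
proof -
  have "\<forall>x \<in> pverts G - B. card (nbrs G x) \<ge> 2"
    using assms(4,5) by simp
  \<comment> \<open>The hypotheses are symmetric in \<open>u\<close> and \<open>v\<close>, so
    exchanging them in \<open>solution_le\<close> gives the reverse inequality.\<close>
  then show ?thesis
    using solution_le[OF assms(1) _ assms(6)] assms(7,8) by (meson order_antisym)
qed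

end
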